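(* Let $R$ be an associative ring with $1$, let $M$ be a left $R$-module, let $N$ and $K$ be submodules of $M$ and let $\sigma$ be a preradical over $R$-Mod. Then: (1) If $K\unlhd_\sigma M$ and $K\leq N$, then $N\unlhd_\sigma M$. If $\sigma$ is prehereditary, then moreover: (2) for every $x\in M$, if $N\unlhd_\sigma M$ then $(N:x)\unlhd_\sigma R$; (3) if $K\unlhd_\sigma M$ and $N\unlhd_\sigma M$, then $N\cap K\unlhd_\sigma M$; (4) if $K\unlhd_\sigma M$ and $K\leq N$, then $K\unlhd_\sigma N$; (5) if $N\leq M$ and $K\unlhd_\sigma M$, then $K\cap N\unlhd_\sigma N$. If $\sigma$ is essentially coidempotent, then: (6) if $K\unlhd_\sigma N$ (so in particular $K\leq N$) and $N\unlhd_\sigma M$, then $K\unlhd_\sigma M$.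
   Context: $R$-Mod is the category of unitary left $R$-modules. A preradical over $R$-Mod is a subfunctor of the identity functor. For a submodule $N\leq M$, $N\unlhd_\sigma M$ ("$N$ is $\sigma$-dense in $M$") means $\sigma(M/N)=M/N$. For $x\in M$, $(N:x)=\{r\in R\mid rx\in N\}$. $\sigma$ is prehereditary if the class $\mathbb{T}_\sigma=\{M\mid\sigma(M)=M\}$ is closed under submodules. $\bar{\sigma}$ denotes the least radical above $\sigma$ (a radical is a preradical $\rho$ with $\rho(M/\rho(M))=0$ for all $M$); explicitly $\bar{\sigma}(M)=\bigcap\{N\leq M\mid\sigma(M/N)=0\}$. $\sigma$ is essentially coidempotent if, for every module $M$, $\bar{\sigma}(M)=M$ implies $\sigma(M)=M$. *)

theory Defs
  imports "HOL-Algebra.Algebra"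
begin

section \<open>Left modules over a ring that need not be commutative\<close>

text \<open>
  The library locale \<^locale>\<open>module\<close> assumes a commutative ring. The record type \<^type>\<open>module_ext\<close>
  and the locale \<^locale>\<open>submodule\<close> do not, so they are reused. The ring multiplication and unit
  that the record inherits are irrelevant for modules, and left unspecified.
\<close>

locale left_module = R?: ring R + M?: abelian_group M
  for R :: "('r, 'e) ring_scheme" (structure) and M :: "('r, 'm, 'f) module_scheme" (structure) +
  assumes smult_closed [simp, intro]:
      "\<lbrakk>a \<in> carrier R; x \<in> carrier M\<rbrakk> \<Longrightarrow> a \<odot>\<^bsub>M\<^esub> x \<in> carrier M"
    and smult_l_distr:
      "\<lbrakk>a \<in> carrier R; b \<in> carrier R; x \<in> carrier M\<rbrakk>
        \<Longrightarrow> (a \<oplus>\<^bsub>R\<^esub> b) \<odot>\<^bsub>M\<^esub> x = (a \<odot>\<^bsub>M\<^esub> x) \<oplus>\<^bsub>M\<^esub> (b \<odot>\<^bsub>M\<^esub> x)"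
    and smult_r_distr:
      "\<lbrakk>a \<in> carrier R; x \<in> carrier M; y \<in> carrier M\<rbrakk>
        \<Longrightarrow> a \<odot>\<^bsub>M\<^esub> (x \<oplus>\<^bsub>M\<^esub> y) = (a \<odot>\<^bsub>M\<^esub> x) \<oplus>\<^bsub>M\<^esub> (a \<odot>\<^bsub>M\<^esub> y)"
    and smult_assoc1:
      "\<lbrakk>a \<in> carrier R; b \<in> carrier R; x \<in> carrier M\<rbrakk>
        \<Longrightarrow> (a \<otimes>\<^bsub>R\<^esub> b) \<odot>\<^bsub>M\<^esub> x = a \<odot>\<^bsub>M\<^esub> (b \<odot>\<^bsub>M\<^esub> x)"
    and smult_one [simp]: "x \<in> carrier M \<Longrightarrow> \<one>\<^bsub>R\<^esub> \<odot>\<^bsub>M\<^esub> x = x"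

definition lmod_hom ::
    "('r, 'e) ring_scheme \<Rightarrow> ('r, 'a, 'f) module_scheme \<Rightarrow> ('r, 'b, 'g) module_scheme \<Rightarrow> ('a \<Rightarrow> 'b) set"
  where "lmod_hom R M M' = {f \<in> carrier M \<rightarrow> carrier M'.
     (\<forall>x\<in>carrier M. \<forall>y\<in>carrier M. f (x \<oplus>\<^bsub>M\<^esub> y) = f x \<oplus>\<^bsub>M'\<^esub> f y) \<and>
     (\<forall>r\<in>carrier R. \<forall>x\<in>carrier M. f (r \<odot>\<^bsub>M\<^esub> x) = r \<odot>\<^bsub>M'\<^esub> f x)}"

definition lmod_iso ::
    "('r, 'e) ring_scheme \<Rightarrow> ('r, 'a, 'f) module_scheme \<Rightarrow> ('r, 'b, 'g) module_scheme \<Rightarrow> ('a \<Rightarrow> 'b) set"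
  where "lmod_iso R M M' = {f \<in> lmod_hom R M M'. bij_betw f (carrier M) (carrier M')}"

definition regular_module :: "('r, 'e) ring_scheme \<Rightarrow> ('r, 'r) module"
  where "regular_module R = \<lparr>carrier = carrier R, monoid.mult = undefined, monoid.one = undefined,
    ring.zero = \<zero>\<^bsub>R\<^esub>, ring.add = ring.add R, smult = monoid.mult R\<rparr>"

definition quot_module :: "('r, 'm, 'f) module_scheme \<Rightarrow> 'm set \<Rightarrow> ('r, 'm set) module"
  where "quot_module M N = \<lparr>carrier = a_rcosets\<^bsub>M\<^esub> N, monoid.mult = undefined, monoid.one = undefined,
    ring.zero = N, ring.add = set_add M, smult = (\<lambda>r A. \<Union>a\<in>A. N +>\<^bsub>M\<^esub> (r \<odot>\<^bsub>M\<^esub> a))\<rparr>"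

definition residual ::
    "('r, 'e) ring_scheme \<Rightarrow> ('r, 'm, 'f) module_scheme \<Rightarrow> 'm set \<Rightarrow> 'm \<Rightarrow> 'r set"
  where "residual R M N x = {r \<in> carrier R. r \<odot>\<^bsub>M\<^esub> x \<in> N}"


section \<open>Preradicals\<close>

text \<open>
  The objects of R-Mod are the left modules whose elements belong to a type \<open>'u\<close>, which serves
  as the universe. If \<open>'u\<close> is infinite, the universe is closed under finite products up to isomorphism;
  closure under submodules and quotients holds for every \<open>'u\<close>.
\<close>

definition preradical :: "('r, 'e) ring_scheme \<Rightarrow> (('r, 'u) module \<Rightarrow> 'u set) \<Rightarrow> bool"
  where "preradical R \<sigma> \<longleftrightarrow>
    (\<forall>M. left_module R M \<longrightarrow> submodule (\<sigma> M) R M) \<and>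
    (\<forall>M M' f. left_module R M \<and> left_module R M' \<and> f \<in> lmod_hom R M M' \<longrightarrow> f ` \<sigma> M \<subseteq> \<sigma> M')"

text \<open>
  A quotient of an object has cosets as elements, and the regular module has ring elements, so
  these modules live on the types \<open>'u set\<close> and \<open>'r\<close> instead of \<open>'u\<close>. The value of a preradical at a
  module on another type is obtained by transport along an isomorphism to an object. The choice of
  the isomorphism is immaterial (lemma \<open>pr_at_iso\<close>), on objects the value is the original one
  (lemma \<open>pr_at_object\<close>), and quotients of objects always are isomorphic to objects
  (lemma \<open>quot_has_copy\<close>).
\<close>

definition pr_at ::
    "('r, 'e) ring_scheme \<Rightarrow> (('r, 'u) module \<Rightarrow> 'u set) \<Rightarrow> ('r, 'q) module \<Rightarrow> 'q set"
  where "pr_at R \<sigma> Q = {q \<in> carrier Q.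
    \<exists>(Q' :: ('r, 'u) module) f. left_module R Q' \<and> f \<in> lmod_iso R Q Q' \<and> f q \<in> \<sigma> Q'}"

definition sigma_dense ::
    "('r, 'e) ring_scheme \<Rightarrow> (('r, 'u) module \<Rightarrow> 'u set) \<Rightarrow> 'm set \<Rightarrow> ('r, 'm) module \<Rightarrow> bool"
  where "sigma_dense R \<sigma> N M \<longleftrightarrow>
    submodule N R M \<and> pr_at R \<sigma> (quot_module M N) = carrier (quot_module M N)"

definition torsion_class ::
    "('r, 'e) ring_scheme \<Rightarrow> (('r, 'u) module \<Rightarrow> 'u set) \<Rightarrow> ('r, 'u) module set"
  where "torsion_class R \<sigma> = {M. left_module R M \<and> \<sigma> M = carrier M}"

definition prehereditary :: "('r, 'e) ring_scheme \<Rightarrow> (('r, 'u) module \<Rightarrow> 'u set) \<Rightarrow> bool"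
  where "prehereditary R \<sigma> \<longleftrightarrow>
    (\<forall>M\<in>torsion_class R \<sigma>. \<forall>N. submodule N R M \<longrightarrow> M\<lparr>carrier := N\<rparr> \<in> torsion_class R \<sigma>)"

definition radical :: "('r, 'e) ring_scheme \<Rightarrow> (('r, 'u) module \<Rightarrow> 'u set) \<Rightarrow> bool"
  where "radical R \<rho> \<longleftrightarrow> preradical R \<rho> \<and>
    (\<forall>M. left_module R M \<longrightarrow> pr_at R \<rho> (quot_module M (\<rho> M)) = {\<zero>\<^bsub>quot_module M (\<rho> M)\<^esub>})"

text \<open>Lemma \<open>radical_hull_least\<close> shows that this is the least radical above \<open>\<sigma>\<close>.\<close>

definition radical_hull ::
    "('r, 'e) ring_scheme \<Rightarrow> (('r, 'u) module \<Rightarrow> 'u set) \<Rightarrow> ('r, 'u) module \<Rightarrow> 'u set"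
  where "radical_hull R \<sigma> M =
    \<Inter>{N. submodule N R M \<and> pr_at R \<sigma> (quot_module M N) = {\<zero>\<^bsub>quot_module M N\<^esub>}}"

definition essentially_coidempotent ::
    "('r, 'e) ring_scheme \<Rightarrow> (('r, 'u) module \<Rightarrow> 'u set) \<Rightarrow> bool"
  where "essentially_coidempotent R \<sigma> \<longleftrightarrow>
    (\<forall>M. left_module R M \<longrightarrow> radical_hull R \<sigma> M = carrier M \<longrightarrow> \<sigma> M = carrier M)"


section \<open>Basic facts\<close>

subsection \<open>Submodules and homomorphisms\<close>

context left_module
begin

lemma smult_zero_right [simp]:
  assumes "a \<in> carrier R" shows "a \<odot>\<^bsub>M\<^esub> \<zero>\<^bsub>M\<^esub> = \<zero>\<^bsub>M\<^esub>"
proof -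
  have "a \<odot>\<^bsub>M\<^esub> \<zero>\<^bsub>M\<^esub> \<oplus>\<^bsub>M\<^esub> a \<odot>\<^bsub>M\<^esub> \<zero>\<^bsub>M\<^esub> = a \<odot>\<^bsub>M\<^esub> \<zero>\<^bsub>M\<^esub>"
    using assms smult_r_distr[of a "\<zero>\<^bsub>M\<^esub>" "\<zero>\<^bsub>M\<^esub>"] by simp
  then show ?thesis using assms by (metis M.add.r_cancel_one smult_closed M.zero_closed)
qed

lemma smult_neg_right:
  assumes "a \<in> carrier R" "x \<in> carrier M" shows "a \<odot>\<^bsub>M\<^esub> (\<ominus>\<^bsub>M\<^esub> x) = \<ominus>\<^bsub>M\<^esub> (a \<odot>\<^bsub>M\<^esub> x)"
proof -
  have "a \<odot>\<^bsub>M\<^esub> (\<ominus>\<^bsub>M\<^esub> x) \<oplus>\<^bsub>M\<^esub> a \<odot>\<^bsub>M\<^esub> x = \<zero>\<^bsub>M\<^esub>"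
    using assms smult_r_distr[of a "\<ominus>\<^bsub>M\<^esub> x" x] by (simp add: M.l_neg)
  then show ?thesis using assms by (metis M.minus_equality smult_closed M.a_inv_closed)
qed

lemma submodule_subset: "submodule N R M \<Longrightarrow> N \<subseteq> carrier M"
  using subgroup.subset[OF submodule.axioms(1)] by force

lemma submodule_abelian: "submodule N R M \<Longrightarrow> abelian_subgroup N M"
  by (intro abelian_subgroupI3 additive_subgroup.intro submodule.axioms(1) M.abelian_group_axioms)

lemma submoduleI:
  assumes "N \<subseteq> carrier M" "\<zero>\<^bsub>M\<^esub> \<in> N"
    and "\<And>x y. \<lbrakk>x \<in> N; y \<in> N\<rbrakk> \<Longrightarrow> x \<oplus>\<^bsub>M\<^esub> y \<in> N"
    and "\<And>x. x \<in> N \<Longrightarrow> \<ominus>\<^bsub>M\<^esub> x \<in> N"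
    and "\<And>r x. \<lbrakk>r \<in> carrier R; x \<in> N\<rbrakk> \<Longrightarrow> r \<odot>\<^bsub>M\<^esub> x \<in> N"
  shows "submodule N R M"
  using assms by (intro submodule.intro subgroup.intro) (auto simp: submodule_axioms_def a_inv_def)

lemma submodule_carrier: "submodule (carrier M) R M"
  by (intro submoduleI) auto

lemma submodule_zero_mem: "submodule N R M \<Longrightarrow> \<zero>\<^bsub>M\<^esub> \<in> N"
  using subgroup.one_closed[OF submodule.axioms(1)] by force

lemma submodule_Inter:
  assumes "\<N> \<noteq> {}" "\<And>N. N \<in> \<N> \<Longrightarrow> submodule N R M"
  shows "submodule (\<Inter>\<N>) R M"
proof (intro submoduleI)
  have ab: "additive_subgroup N M" if "N \<in> \<N>" for N
    using assms(2)[OF that] submodule_abelian abelian_subgroup.axioms(1) by blast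
  show "\<Inter>\<N> \<subseteq> carrier M" using assms submodule_subset by blast
  show "\<zero>\<^bsub>M\<^esub> \<in> \<Inter>\<N>" using assms submodule_zero_mem by blast
  show "x \<oplus>\<^bsub>M\<^esub> y \<in> \<Inter>\<N>" if "x \<in> \<Inter>\<N>" "y \<in> \<Inter>\<N>" for x y
    using that additive_subgroup.a_closed[OF ab] by blast
  show "\<ominus>\<^bsub>M\<^esub> x \<in> \<Inter>\<N>" if "x \<in> \<Inter>\<N>" for x
    using that additive_subgroup.a_inv_closed[OF ab] by blast
  show "r \<odot>\<^bsub>M\<^esub> x \<in> \<Inter>\<N>" if "r \<in> carrier R" "x \<in> \<Inter>\<N>" for r x
    using that submodule.smult_closed[OF assms(2)] by blast
qed

end

lemma lmod_homD:
  assumes "f \<in> lmod_hom R M M'"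
  shows "x \<in> carrier M \<Longrightarrow> f x \<in> carrier M'"
    and "\<lbrakk>x \<in> carrier M; y \<in> carrier M\<rbrakk> \<Longrightarrow> f (x \<oplus>\<^bsub>M\<^esub> y) = f x \<oplus>\<^bsub>M'\<^esub> f y"
    and "\<lbrakk>r \<in> carrier R; x \<in> carrier M\<rbrakk> \<Longrightarrow> f (r \<odot>\<^bsub>M\<^esub> x) = r \<odot>\<^bsub>M'\<^esub> f x"
  using assms by (auto simp: lmod_hom_def)

lemma lmod_hom_comp:
  "\<lbrakk>f \<in> lmod_hom R M M'; g \<in> lmod_hom R M' M''\<rbrakk> \<Longrightarrow> g \<circ> f \<in> lmod_hom R M M''"
  by (auto simp: lmod_hom_def Pi_iff)

lemma lmod_hom_zero:
  assumes "left_module R M" "left_module R M'" "f \<in> lmod_hom R M M'"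
  shows "f \<zero>\<^bsub>M\<^esub> = \<zero>\<^bsub>M'\<^esub>"
proof -
  interpret M: left_module R M by fact
  interpret M': left_module R M' by fact
  have "f \<zero>\<^bsub>M\<^esub> \<oplus>\<^bsub>M'\<^esub> f \<zero>\<^bsub>M\<^esub> = f \<zero>\<^bsub>M\<^esub>"
    using lmod_homD(2)[OF assms(3), of "\<zero>\<^bsub>M\<^esub>" "\<zero>\<^bsub>M\<^esub>"] by simp
  then show ?thesis
    using lmod_homD(1)[OF assms(3)] by (metis M'.M.add.r_cancel_one M.M.zero_closed)
qed

lemma lmod_hom_neg:
  assumes "left_module R M" "left_module R M'" "f \<in> lmod_hom R M M'" "x \<in> carrier M"
  shows "f (\<ominus>\<^bsub>M\<^esub> x) = \<ominus>\<^bsub>M'\<^esub> f x"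
proof -
  interpret M: left_module R M by fact
  interpret M': left_module R M' by fact
  have "f (\<ominus>\<^bsub>M\<^esub> x) \<oplus>\<^bsub>M'\<^esub> f x = \<zero>\<^bsub>M'\<^esub>"
    using lmod_homD(2)[OF assms(3), of "\<ominus>\<^bsub>M\<^esub> x" x] assms lmod_hom_zero[OF assms(1-3)]
    by (simp add: M.M.l_neg)
  then show ?thesis
    using lmod_homD(1)[OF assms(3)] assms(4) by (metis M'.M.minus_equality M.M.a_inv_closed)
qed

lemma lmod_hom_factor:
  assumes M: "left_module R M" and p: "p \<in> lmod_hom R M Q" "p ` carrier M = carrier Q"
    and g: "g \<in> lmod_hom R M P"
    and ker: "\<And>x y. \<lbrakk>x \<in> carrier M; y \<in> carrier M; p x = p y\<rbrakk> \<Longrightarrow> g x = g y"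
  obtains h where "h \<in> lmod_hom R Q P" "\<And>x. x \<in> carrier M \<Longrightarrow> h (p x) = g x"
proof -
  interpret M: left_module R M by fact
  define h where "h = g \<circ> inv_into (carrier M) p"
  have h: "h (p x) = g x" if "x \<in> carrier M" for x
    unfolding h_def comp_def
    by (rule ker) (simp_all add: that inv_into_into f_inv_into_f)
  have rep: "\<exists>x\<in>carrier M. q = p x" if "q \<in> carrier Q" for q
    using that unfolding p(2)[symmetric] by blast
  have "h \<in> lmod_hom R Q P"
    unfolding lmod_hom_def
  proof (intro CollectI conjI ballI Pi_I)
    fix q assume "q \<in> carrier Q"
    then obtain x where x: "x \<in> carrier M" "q = p x" using rep by blast
    show "h q \<in> carrier P"
      unfolding x(2) h[OF x(1)] by (rule lmod_homD(1)[OF g x(1)])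
    show "h (r \<odot>\<^bsub>Q\<^esub> q) = r \<odot>\<^bsub>P\<^esub> h q" if r: "r \<in> carrier R" for r
      unfolding x(2) h[OF x(1)] lmod_homD(3)[OF p(1) r x(1), symmetric]
        h[OF M.smult_closed[OF r x(1)]] by (rule lmod_homD(3)[OF g r x(1)])
    fix q' assume "q' \<in> carrier Q"
    then obtain y where y: "y \<in> carrier M" "q' = p y" using rep by blast
    show "h (q \<oplus>\<^bsub>Q\<^esub> q') = h q \<oplus>\<^bsub>P\<^esub> h q'"
      unfolding x(2) y(2) h[OF x(1)] h[OF y(1)] lmod_homD(2)[OF p(1) x(1) y(1), symmetric]
        h[OF M.M.a_closed[OF x(1) y(1)]] by (rule lmod_homD(2)[OF g x(1) y(1)])
  qed
  then show ?thesis using h by (rule that)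
qed

lemma lmod_isoD:
  assumes "f \<in> lmod_iso R M M'"
  shows "f \<in> lmod_hom R M M'" "inj_on f (carrier M)" "f ` carrier M = carrier M'"
  using assms by (auto simp: lmod_iso_def bij_betw_def)

lemma lmod_iso_factor:
  assumes "left_module R M" "e \<in> lmod_iso R M Q" "g \<in> lmod_hom R M P"
  obtains h where "h \<in> lmod_hom R Q P" "\<And>x. x \<in> carrier M \<Longrightarrow> h (e x) = g x"
proof (rule lmod_hom_factor[OF assms(1) lmod_isoD(1,3)[OF assms(2)] assms(3)])
  show "g x = g y" if "x \<in> carrier M" "y \<in> carrier M" "e x = e y" for x y
    using inj_onD[OF lmod_isoD(2)[OF assms(2)] that(3,1,2)] by simp
qed (rule that)


subsection \<open>Surjective images and quotients\<close>

lemma left_module_image: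
  assumes M: "left_module R M" and f: "f \<in> lmod_hom R M Q" and surj: "f ` carrier M = carrier Q"
    and z: "f \<zero>\<^bsub>M\<^esub> = \<zero>\<^bsub>Q\<^esub>"
  shows "left_module R Q"
proof -
  interpret M: left_module R M by fact
  have fa: "f x \<oplus>\<^bsub>Q\<^esub> f y = f (x \<oplus>\<^bsub>M\<^esub> y)" if "x \<in> carrier M" "y \<in> carrier M" for x y
    using that lmod_homD(2)[OF f] by simp
  have fs: "r \<odot>\<^bsub>Q\<^esub> f x = f (r \<odot>\<^bsub>M\<^esub> x)" if "r \<in> carrier R" "x \<in> carrier M" for r x
    using that lmod_homD(3)[OF f] by simp
  have "abelian_group Q"
  proof (rule abelian_groupI)
    fix x assume "x \<in> carrier Q"
    then obtain a where a: "a \<in> carrier M" "x = f a" using surj by blast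
    then have "f (\<ominus>\<^bsub>M\<^esub> a) \<oplus>\<^bsub>Q\<^esub> x = \<zero>\<^bsub>Q\<^esub>" by (simp add: fa M.M.l_neg z)
    then show "\<exists>y\<in>carrier Q. y \<oplus>\<^bsub>Q\<^esub> x = \<zero>\<^bsub>Q\<^esub>" using a surj by blast
  qed (auto simp: surj[symmetric] z[symmetric] fa M.M.a_ac)
  then show ?thesis
    by (intro left_module.intro left_module_axioms.intro M.R.ring_axioms)
      (auto simp: surj[symmetric] fa fs M.smult_l_distr M.smult_r_distr M.smult_assoc1)
qed

lemma regular_left_module:
  assumes "ring R" shows "left_module R (regular_module R)"
proof -
  interpret ring R by fact
  have "abelian_group (regular_module R)"
    by (rule abelian_groupI) (auto simp: regular_module_def a_ac intro!: bexI[of _ "\<ominus>\<^bsub>R\<^esub> _"] l_neg)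
  then show ?thesis
    by (intro left_module.intro left_module_axioms.intro assms)
      (auto simp: regular_module_def l_distr r_distr m_assoc)
qed

lemma has_copy_inj:
  fixes Q :: "('r, 'q) module" and e :: "'q \<Rightarrow> 'u"
  assumes Q: "left_module R Q" and e: "inj_on e (carrier Q)"
  obtains Q' :: "('r, 'u) module" where "left_module R Q'" "e \<in> lmod_iso R Q Q'"
proof -
  interpret Q: left_module R Q by fact
  let ?i = "inv_into (carrier Q) e"
  define Q' :: "('r, 'u) module" where "Q' = \<lparr>carrier = e ` carrier Q, monoid.mult = undefined,
    monoid.one = undefined, ring.zero = e \<zero>\<^bsub>Q\<^esub>, ring.add = (\<lambda>x y. e (?i x \<oplus>\<^bsub>Q\<^esub> ?i y)),
    smult = (\<lambda>r x. e (r \<odot>\<^bsub>Q\<^esub> ?i x))\<rparr>"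
  have hom: "e \<in> lmod_hom R Q Q'"
    using e by (auto simp: lmod_hom_def Q'_def)
  moreover have "left_module R Q'"
    by (rule left_module_image[OF Q hom]) (auto simp: Q'_def)
  ultimately show ?thesis
    using that[of Q'] e by (auto simp: lmod_iso_def bij_betw_def Q'_def)
qed

context
  fixes R :: "('r, 'e) ring_scheme" and M :: "('r, 'm) module" and N
  assumes M: "left_module R M" and N: "submodule N R M"
begin

interpretation left_module R M by (rule M)
interpretation N: abelian_subgroup N M by (rule submodule_abelian[OF N])

lemma quot_smult_coset:
  assumes "r \<in> carrier R" "x \<in> carrier M"
  shows "r \<odot>\<^bsub>quot_module M N\<^esub> (N +>\<^bsub>M\<^esub> x) = N +>\<^bsub>M\<^esub> (r \<odot>\<^bsub>M\<^esub> x)"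
proof -
  have "N +>\<^bsub>M\<^esub> (r \<odot>\<^bsub>M\<^esub> a) = N +>\<^bsub>M\<^esub> (r \<odot>\<^bsub>M\<^esub> x)" if "a \<in> N +>\<^bsub>M\<^esub> x" for a
  proof -
    have a: "a \<in> carrier M" "a \<oplus>\<^bsub>M\<^esub> \<ominus>\<^bsub>M\<^esub> x \<in> N"
      using N.a_elemrcos_carrier[OF assms(2) that] N.a_rcos_module_imp[OF assms(2) that] by auto
    then have "r \<odot>\<^bsub>M\<^esub> (a \<oplus>\<^bsub>M\<^esub> \<ominus>\<^bsub>M\<^esub> x) \<in> N"
      using submodule.smult_closed[OF N assms(1)] by simp
    then have "r \<odot>\<^bsub>M\<^esub> a \<oplus>\<^bsub>M\<^esub> \<ominus>\<^bsub>M\<^esub> (r \<odot>\<^bsub>M\<^esub> x) \<in> N"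
      using a assms by (simp add: smult_r_distr smult_neg_right)
    then have "r \<odot>\<^bsub>M\<^esub> a \<in> N +>\<^bsub>M\<^esub> (r \<odot>\<^bsub>M\<^esub> x)"
      using a assms by (intro N.a_rcos_module_rev) auto
    then show ?thesis using N.a_repr_independence'[OF _ smult_closed[OF assms]] by simp
  qed
  then have "(\<Union>a\<in>N +>\<^bsub>M\<^esub> x. N +>\<^bsub>M\<^esub> (r \<odot>\<^bsub>M\<^esub> a)) = (\<Union>a\<in>N +>\<^bsub>M\<^esub> x. N +>\<^bsub>M\<^esub> (r \<odot>\<^bsub>M\<^esub> x))"
    by (rule SUP_cong[OF refl])
  also have "\<dots> = N +>\<^bsub>M\<^esub> (r \<odot>\<^bsub>M\<^esub> x)" using N.a_rcos_self[OF assms(2)] by blast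
  finally show ?thesis by (simp add: quot_module_def)
qed

lemma quot_proj_hom: "(\<lambda>x. N +>\<^bsub>M\<^esub> x) \<in> lmod_hom R M (quot_module M N)"
  unfolding lmod_hom_def
proof (intro CollectI conjI ballI Pi_I)
  show "N +>\<^bsub>M\<^esub> x \<in> carrier (quot_module M N)" if "x \<in> carrier M" for x
    using a_rcosetsI[OF N.a_subset that] by (simp add: quot_module_def)
  show "N +>\<^bsub>M\<^esub> (x \<oplus>\<^bsub>M\<^esub> y) = (N +>\<^bsub>M\<^esub> x) \<oplus>\<^bsub>quot_module M N\<^esub> (N +>\<^bsub>M\<^esub> y)"
    if "x \<in> carrier M" "y \<in> carrier M" for x y
    using N.a_rcos_sum[OF that] by (simp add: quot_module_def)
qed (simp add: quot_smult_coset)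

lemma quot_proj_surj: "(\<lambda>x. N +>\<^bsub>M\<^esub> x) ` carrier M = carrier (quot_module M N)"
  by (auto simp: quot_module_def A_RCOSETS_def')

lemma quot_proj_eq_zero:
  "x \<in> carrier M \<Longrightarrow> N +>\<^bsub>M\<^esub> x = \<zero>\<^bsub>quot_module M N\<^esub> \<longleftrightarrow> x \<in> N"
  using N.a_rcos_self[of x] N.a_rcos_const[of x] by (simp add: quot_module_def) blast

lemma quot_proj_eq:
  "\<lbrakk>x \<in> carrier M; y \<in> carrier M\<rbrakk> \<Longrightarrow> N +>\<^bsub>M\<^esub> x = N +>\<^bsub>M\<^esub> y \<longleftrightarrow> x \<oplus>\<^bsub>M\<^esub> \<ominus>\<^bsub>M\<^esub> y \<in> N"
  using N.a_rcos_module[of y x] N.a_rcos_self[of x] N.a_repr_independence'[of x y] by auto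

lemma quot_left_module: "left_module R (quot_module M N)"
  by (rule left_module_image[OF M quot_proj_hom quot_proj_surj])
    (simp add: quot_proj_eq_zero)

lemma quot_has_copy:
  obtains Q' :: "('r, 'm) module" and f where "left_module R Q'" "f \<in> lmod_iso R (quot_module M N) Q'"
proof -
  have ne: "(SOME a. a \<in> A) \<in> A" if "A \<in> carrier (quot_module M N)" for A
  proof -
    have "A \<in> (\<lambda>x. N +>\<^bsub>M\<^esub> x) ` carrier M" using that by (simp add: quot_proj_surj)
    then obtain x where "x \<in> carrier M" "A = N +>\<^bsub>M\<^esub> x" by blast
    then have "x \<in> A" using N.a_rcos_self by simp
    then show ?thesis by (rule someI)
  qed
  have "inj_on (\<lambda>A. SOME a. a \<in> A) (carrier (quot_module M N))"
  proof (rule inj_onI)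
    fix A B assume *: "A \<in> carrier (quot_module M N)" "B \<in> carrier (quot_module M N)"
      "(SOME a. a \<in> A) = (SOME a. a \<in> B)"
    then have "\<not> disjnt A B" using ne[OF *(1)] ne[OF *(2)] unfolding disjnt_iff by auto
    moreover have "A \<in> a_rcosets\<^bsub>M\<^esub> N" "B \<in> a_rcosets\<^bsub>M\<^esub> N"
      using *(1,2) by (simp_all add: quot_module_def)
    ultimately show "A = B" using N.a_rcos_disjoint unfolding pairwise_def by blast
  qed
  then show ?thesis by (rule has_copy_inj[OF quot_left_module]) (rule that)
qed

end


subsection \<open>Values of a preradical on modules over other types\<close>

lemma preradicalD:
  assumes "preradical R \<sigma>" "left_module R M"
  shows "submodule (\<sigma> M) R M"
    and "\<lbrakk>left_module R M'; f \<in> lmod_hom R M M'; x \<in> \<sigma> M\<rbrakk> \<Longrightarrow> f x \<in> \<sigma> M'"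
  using assms unfolding preradical_def by (simp, blast)

lemma pr_atI:
  assumes "q \<in> carrier Q" "left_module R Q'" "f \<in> lmod_iso R Q Q'" "f q \<in> \<sigma> Q'"
  shows "q \<in> pr_at R \<sigma> Q"
  unfolding pr_at_def mem_Collect_eq by (intro conjI exI) (rule assms)+

lemma pr_atE:
  assumes "q \<in> pr_at R \<sigma> Q"
  obtains Q' f where "q \<in> carrier Q" "left_module R Q'" "f \<in> lmod_iso R Q Q'" "f q \<in> \<sigma> Q'"
  using assms unfolding pr_at_def mem_Collect_eq by (elim conjE exE) (rule that)

lemma pr_at_hom:
  fixes \<sigma> :: "('r, 'u) module \<Rightarrow> 'u set" and P' :: "('r, 'u) module"
    and Q :: "('r, 'q) module" and P :: "('r, 'p) module"
  assumes \<sigma>: "preradical R \<sigma>" and Q: "left_module R Q" and f: "f \<in> lmod_hom R Q P"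
    and P': "left_module R P'" "g \<in> lmod_iso R P P'" and q: "q \<in> pr_at R \<sigma> Q"
  shows "f q \<in> pr_at R \<sigma> P"
proof -
  obtain Q' :: "('r, 'u) module" and e where e: "left_module R Q'" "e \<in> lmod_iso R Q Q'" "e q \<in> \<sigma> Q'"
    and qQ: "q \<in> carrier Q"
    by (rule pr_atE[OF q]) (rule that)
  obtain h where h: "h \<in> lmod_hom R Q' P'" "\<And>x. x \<in> carrier Q \<Longrightarrow> h (e x) = (g \<circ> f) x"
    by (rule lmod_iso_factor[OF Q e(2) lmod_hom_comp[OF f lmod_isoD(1)[OF P'(2)]]]) (rule that)
  have "h (e q) \<in> \<sigma> P'"
    by (rule preradicalD(2)[OF \<sigma> e(1) P'(1) h(1) e(3)])
  then have "g (f q) \<in> \<sigma> P'" using h(2)[OF qQ] by simp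
  then show ?thesis
    by (rule pr_atI[where f = g, OF lmod_homD(1)[OF f qQ] P'])
qed

lemma pr_at_iso:
  fixes \<sigma> :: "('r, 'u) module \<Rightarrow> 'u set" and Q' :: "('r, 'u) module" and Q :: "('r, 'q) module"
  assumes \<sigma>: "preradical R \<sigma>" and Q: "left_module R Q"
    and Q': "left_module R Q'" and f: "f \<in> lmod_iso R Q Q'"
  shows "pr_at R \<sigma> Q = {q \<in> carrier Q. f q \<in> \<sigma> Q'}"
proof (intro equalityI subsetI CollectI conjI)
  fix q assume q: "q \<in> pr_at R \<sigma> Q"
  then show "q \<in> carrier Q" by (simp add: pr_at_def)
  have id: "id \<in> lmod_iso R Q' Q'" by (auto simp: lmod_iso_def lmod_hom_def)
  have "f q \<in> pr_at R \<sigma> Q'"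
    by (rule pr_at_hom[OF \<sigma> Q lmod_isoD(1)[OF f] Q' id q])
  then obtain P :: "('r, 'u) module" and e where
    e: "left_module R P" "e \<in> lmod_iso R Q' P" "e (f q) \<in> \<sigma> P" "f q \<in> carrier Q'"
    by (rule pr_atE) (rule that)
  obtain h where h: "h \<in> lmod_hom R P Q'" "\<And>x. x \<in> carrier Q' \<Longrightarrow> h (e x) = id x"
    by (rule lmod_iso_factor[OF Q' e(2) lmod_isoD(1)[OF id]]) (rule that)
  have "h (e (f q)) \<in> \<sigma> Q'" by (rule preradicalD(2)[OF \<sigma> e(1) Q' h(1) e(3)])
  then show "f q \<in> \<sigma> Q'" using h(2) e(4) by simp
next
  fix q assume "q \<in> {q \<in> carrier Q. f q \<in> \<sigma> Q'}"
  then have q: "q \<in> carrier Q" "f q \<in> \<sigma> Q'" by auto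
  show "q \<in> pr_at R \<sigma> Q"
    by (rule pr_atI[where f = f and \<sigma> = \<sigma>, OF q(1) Q' f q(2)])
qed

lemma pr_at_object:
  fixes \<sigma> :: "('r, 'u) module \<Rightarrow> 'u set" and M :: "('r, 'u) module"
  assumes "preradical R \<sigma>" "left_module R M"
  shows "pr_at R \<sigma> M = \<sigma> M"
proof -
  have "id \<in> lmod_iso R M M" by (auto simp: lmod_iso_def lmod_hom_def)
  moreover have "\<sigma> M \<subseteq> carrier M"
    using assms left_module.submodule_subset unfolding preradical_def by blast
  ultimately show ?thesis using pr_at_iso[OF assms(1,2,2)] by auto
qed

lemma pr_at_zero:
  fixes \<sigma> :: "('r, 'u) module \<Rightarrow> 'u set" and Q' :: "('r, 'u) module" and Q :: "('r, 'q) module"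
  assumes \<sigma>: "preradical R \<sigma>" and Q: "left_module R Q"
    and Q': "left_module R Q'" "f \<in> lmod_iso R Q Q'"
  shows "\<zero>\<^bsub>Q\<^esub> \<in> pr_at R \<sigma> Q"
proof -
  interpret Q: left_module R Q by fact
  have "\<zero>\<^bsub>Q'\<^esub> \<in> \<sigma> Q'"
    using \<sigma> Q' left_module.submodule_zero_mem unfolding preradical_def by blast
  then show ?thesis
    using lmod_hom_zero[OF Q Q'(1) lmod_isoD(1)[OF Q'(2)]] pr_at_iso[OF assms] by auto
qed


subsection \<open>The least radical above a preradical\<close>

lemma kernel_submodule:
  assumes "left_module R M" "left_module R P" "f \<in> lmod_hom R M P"
  shows "submodule {x \<in> carrier M. f x = \<zero>\<^bsub>P\<^esub>} R M"
proof -
  interpret M: left_module R M by fact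
  interpret P: left_module R P by fact
  show ?thesis
    by (rule M.submoduleI)
      (auto simp: lmod_homD[OF assms(3)] lmod_hom_zero[OF assms] lmod_hom_neg[OF assms])
qed

lemma pr_at_quot_kernel:
  fixes \<sigma> :: "('r, 'u) module \<Rightarrow> 'u set" and M P' :: "('r, 'u) module" and P :: "('r, 'p) module"
  assumes \<sigma>: "preradical R \<sigma>" and M: "left_module R M" and P: "left_module R P"
    and P': "left_module R P'" "g \<in> lmod_iso R P P'" and f: "f \<in> lmod_hom R M P"
    and z: "pr_at R \<sigma> P = {\<zero>\<^bsub>P\<^esub>}"
  defines "K \<equiv> {x \<in> carrier M. f x = \<zero>\<^bsub>P\<^esub>}"
  shows "pr_at R \<sigma> (quot_module M K) = {\<zero>\<^bsub>quot_module M K\<^esub>}"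
proof -
  interpret M: left_module R M by fact
  interpret P: left_module R P by fact
  have K: "submodule K R M" unfolding K_def by (rule kernel_submodule[OF M P f])
  note Q = quot_left_module[OF M K]
  have ker: "f x = f y" if "x \<in> carrier M" "y \<in> carrier M" "K +>\<^bsub>M\<^esub> x = K +>\<^bsub>M\<^esub> y" for x y
  proof -
    have "f (x \<oplus>\<^bsub>M\<^esub> \<ominus>\<^bsub>M\<^esub> y) = \<zero>\<^bsub>P\<^esub>"
      using that quot_proj_eq[OF M K] by (auto simp: K_def)
    then have "f x \<oplus>\<^bsub>P\<^esub> \<ominus>\<^bsub>P\<^esub> f y = \<zero>\<^bsub>P\<^esub>"
      using that by (simp add: lmod_homD[OF f] lmod_hom_neg[OF M P f])
    then show ?thesis
      using that lmod_homD(1)[OF f] P.M.minus_equality[of "f x" "\<ominus>\<^bsub>P\<^esub> f y"] P.M.minus_minus by simp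
  qed
  obtain h where h: "h \<in> lmod_hom R (quot_module M K) P"
      "\<And>x. x \<in> carrier M \<Longrightarrow> h (K +>\<^bsub>M\<^esub> x) = f x"
    by (rule lmod_hom_factor[OF M quot_proj_hom[OF M K] quot_proj_surj[OF M K] f])
      (rule ker, assumption+, rule that)
  have "q = \<zero>\<^bsub>quot_module M K\<^esub>" if q: "q \<in> pr_at R \<sigma> (quot_module M K)" for q
  proof -
    obtain x where x: "x \<in> carrier M" "q = K +>\<^bsub>M\<^esub> x"
      using q quot_proj_surj[OF M K] by (auto simp: pr_at_def)
    have "h q = \<zero>\<^bsub>P\<^esub>" using pr_at_hom[OF \<sigma> Q h(1) P' q] z by simp
    then have "x \<in> K" using x h(2) by (simp add: K_def)
    then show ?thesis using x quot_proj_eq_zero[OF M K] by simp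
  qed
  moreover have "\<zero>\<^bsub>quot_module M K\<^esub> \<in> pr_at R \<sigma> (quot_module M K)"
    by (rule quot_has_copy[OF M K]) (rule pr_at_zero[OF \<sigma> Q])
  ultimately show ?thesis by blast
qed

lemma radical_hull_preradical:
  fixes \<sigma> :: "('r, 'u) module \<Rightarrow> 'u set"
  assumes \<sigma>: "preradical R \<sigma>"
  shows "preradical R (radical_hull R \<sigma>)"
  unfolding preradical_def
proof (intro conjI allI impI)
  fix M :: "('r, 'u) module" assume M: "left_module R M"
  interpret M: left_module R M by fact
  note C = M.submodule_carrier
  have "carrier (quot_module M (carrier M)) = {\<zero>\<^bsub>quot_module M (carrier M)\<^esub>}"
    using quot_proj_eq_zero[OF M C] quot_proj_surj[OF M C] M.M.zero_closed by blast
  moreover have "\<zero>\<^bsub>quot_module M (carrier M)\<^esub> \<in> pr_at R \<sigma> (quot_module M (carrier M))"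
    by (rule quot_has_copy[OF M C]) (rule pr_at_zero[OF \<sigma> quot_left_module[OF M C]])
  moreover have "pr_at R \<sigma> (quot_module M (carrier M)) \<subseteq> carrier (quot_module M (carrier M))"
    by (auto simp: pr_at_def)
  ultimately have "pr_at R \<sigma> (quot_module M (carrier M)) = {\<zero>\<^bsub>quot_module M (carrier M)\<^esub>}"
    by blast
  then show "submodule (radical_hull R \<sigma> M) R M"
    unfolding radical_hull_def by (intro M.submodule_Inter) (use C in auto)
next
  fix M M' :: "('r, 'u) module" and f
  assume "left_module R M \<and> left_module R M' \<and> f \<in> lmod_hom R M M'"
  then have M: "left_module R M" and M': "left_module R M'" and f: "f \<in> lmod_hom R M M'" by auto
  show "f ` radical_hull R \<sigma> M \<subseteq> radical_hull R \<sigma> M'"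
  proof (clarsimp simp: radical_hull_def[of R \<sigma> M'])
    fix x N assume x: "x \<in> radical_hull R \<sigma> M" and N: "submodule N R M'"
      and z: "pr_at R \<sigma> (quot_module M' N) = {\<zero>\<^bsub>quot_module M' N\<^esub>}"
    let ?g = "(\<lambda>x. N +>\<^bsub>M'\<^esub> x) \<circ> f"
    let ?K = "{x \<in> carrier M. ?g x = \<zero>\<^bsub>quot_module M' N\<^esub>}"
    note Q = quot_left_module[OF M' N]
    have g: "?g \<in> lmod_hom R M (quot_module M' N)"
      by (rule lmod_hom_comp[OF f quot_proj_hom[OF M' N]])
    have "pr_at R \<sigma> (quot_module M ?K) = {\<zero>\<^bsub>quot_module M ?K\<^esub>}"
      by (rule quot_has_copy[OF M' N]) (rule pr_at_quot_kernel[OF \<sigma> M Q _ _ g z])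
    then have "x \<in> ?K"
      using x kernel_submodule[OF M Q g] unfolding radical_hull_def by blast
    then show "f x \<in> N" using quot_proj_eq_zero[OF M' N] lmod_homD(1)[OF f] by auto
  qed
qed

lemma radical_hull_least:
  fixes \<sigma> :: "('r, 'u) module \<Rightarrow> 'u set"
  assumes \<sigma>: "preradical R \<sigma>"
  shows "radical R (radical_hull R \<sigma>)"
    and "left_module R M \<Longrightarrow> \<sigma> M \<subseteq> radical_hull R \<sigma> M"
    and "\<lbrakk>radical R \<rho>; \<And>M. left_module R M \<Longrightarrow> \<sigma> M \<subseteq> \<rho> M; left_module R M\<rbrakk>
      \<Longrightarrow> radical_hull R \<sigma> M \<subseteq> \<rho> M"
proof -
  let ?\<beta> = "radical_hull R \<sigma>"
  note \<beta> = radical_hull_preradical[OF \<sigma>]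
  show "radical R ?\<beta>"
    unfolding radical_def
  proof (intro conjI allI impI \<beta>)
    fix M :: "('r, 'u) module" assume M: "left_module R M"
    interpret M: left_module R M by fact
    let ?Q = "quot_module M (?\<beta> M)"
    have B: "submodule (?\<beta> M) R M" using \<beta> M unfolding preradical_def by blast
    note Q = quot_left_module[OF M B]
    obtain Q' :: "('r, 'u) module" and e where e: "left_module R Q'" "e \<in> lmod_iso R ?Q Q'"
      by (rule quot_has_copy[OF M B]) (rule that)
    note pq = pr_at_iso[OF \<beta> Q e]
    have "q = \<zero>\<^bsub>?Q\<^esub>" if q: "q \<in> pr_at R ?\<beta> ?Q" for q
    proof -
      obtain x where x: "x \<in> carrier M" "q = ?\<beta> M +>\<^bsub>M\<^esub> x"
        using q quot_proj_surj[OF M B] by (auto simp: pr_at_def)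
      have eq: "e q \<in> ?\<beta> Q'" using q pq by auto
      have "x \<in> N" if N: "submodule N R M"
        and z: "pr_at R \<sigma> (quot_module M N) = {\<zero>\<^bsub>quot_module M N\<^esub>}" for N
      proof -
        let ?p = "e \<circ> (\<lambda>x. ?\<beta> M +>\<^bsub>M\<^esub> x)"
        have p: "?p \<in> lmod_hom R M Q'"
          by (rule lmod_hom_comp[OF quot_proj_hom[OF M B] lmod_isoD(1)[OF e(2)]])
        have ps: "?p ` carrier M = carrier Q'"
          unfolding image_comp[symmetric] quot_proj_surj[OF M B] by (rule lmod_isoD(3)[OF e(2)])
        have sub: "?\<beta> M \<subseteq> N" using N z unfolding radical_hull_def by blast
        have ker: "N +>\<^bsub>M\<^esub> a = N +>\<^bsub>M\<^esub> b" if "a \<in> carrier M" "b \<in> carrier M" "?p a = ?p b" for a b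
        proof -
          have "?\<beta> M +>\<^bsub>M\<^esub> a = ?\<beta> M +>\<^bsub>M\<^esub> b"
            using that lmod_isoD(2)[OF e(2)] lmod_homD(1)[OF quot_proj_hom[OF M B]]
            by (simp add: inj_on_eq_iff)
          then show ?thesis using that quot_proj_eq[OF M B] quot_proj_eq[OF M N] sub by blast
        qed
        note QN = quot_left_module[OF M N]
        obtain h where h: "h \<in> lmod_hom R Q' (quot_module M N)"
            "\<And>x. x \<in> carrier M \<Longrightarrow> h (?p x) = N +>\<^bsub>M\<^esub> x"
          by (rule lmod_hom_factor[OF M p ps quot_proj_hom[OF M N]])
            (rule ker, assumption+, rule that)
        let ?K = "{y \<in> carrier Q'. h y = \<zero>\<^bsub>quot_module M N\<^esub>}"
        have "pr_at R \<sigma> (quot_module Q' ?K) = {\<zero>\<^bsub>quot_module Q' ?K\<^esub>}"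
          by (rule quot_has_copy[OF M N]) (rule pr_at_quot_kernel[OF \<sigma> e(1) QN _ _ h(1) z])
        then have "e q \<in> ?K"
          using eq kernel_submodule[OF e(1) QN h(1)] unfolding radical_hull_def by blast
        then show "x \<in> N" using x h(2)[OF x(1)] quot_proj_eq_zero[OF M N x(1)] by auto
      qed
      then have "x \<in> ?\<beta> M" unfolding radical_hull_def by blast
      then show ?thesis using x quot_proj_eq_zero[OF M B] by simp
    qed
    moreover have "\<zero>\<^bsub>?Q\<^esub> \<in> pr_at R ?\<beta> ?Q" by (rule pr_at_zero[OF \<beta> Q e])
    ultimately show "pr_at R ?\<beta> ?Q = {\<zero>\<^bsub>?Q\<^esub>}" by blast
  qed
next
  assume M: "left_module R M"
  show "\<sigma> M \<subseteq> radical_hull R \<sigma> M"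
  proof (clarsimp simp: radical_hull_def)
    fix x N assume x: "x \<in> \<sigma> M" and N: "submodule N R M"
      and z: "pr_at R \<sigma> (quot_module M N) = {\<zero>\<^bsub>quot_module M N\<^esub>}"
    have xM: "x \<in> carrier M"
      using x \<sigma> M left_module.submodule_subset unfolding preradical_def by blast
    have "N +>\<^bsub>M\<^esub> x \<in> pr_at R \<sigma> (quot_module M N)"
      by (rule quot_has_copy[OF M N])
        (rule pr_at_hom[OF \<sigma> M quot_proj_hom[OF M N]], simp_all add: pr_at_object[OF \<sigma> M] x)
    then show "x \<in> N" using z quot_proj_eq_zero[OF M N xM] by simp
  qed
next
  assume \<rho>: "radical R \<rho>" and le: "\<And>M. left_module R M \<Longrightarrow> \<sigma> M \<subseteq> \<rho> M" and M: "left_module R M"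
  let ?Q = "quot_module M (\<rho> M)"
  have N: "submodule (\<rho> M) R M" using \<rho> M unfolding radical_def preradical_def by blast
  have "pr_at R \<sigma> ?Q \<subseteq> pr_at R \<rho> ?Q" using le unfolding pr_at_def by blast
  also have "\<dots> = {\<zero>\<^bsub>?Q\<^esub>}" using \<rho> M unfolding radical_def by blast
  finally have "pr_at R \<sigma> ?Q \<subseteq> {\<zero>\<^bsub>?Q\<^esub>}" .
  moreover have "\<zero>\<^bsub>?Q\<^esub> \<in> pr_at R \<sigma> ?Q"
    by (rule quot_has_copy[OF M N]) (rule pr_at_zero[OF \<sigma> quot_left_module[OF M N]])
  ultimately have "pr_at R \<sigma> ?Q = {\<zero>\<^bsub>?Q\<^esub>}" by blast
  then show "radical_hull R \<sigma> M \<subseteq> \<rho> M" using N unfolding radical_hull_def by blast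
qed

end

theory Submission
  imports Defs
begin

text \<open>
  Density of \<open>N\<close> in \<open>M\<close> says that \<open>M/N\<close> lies in the torsion class of \<open>\<sigma>\<close>, so each closure property
  of the torsion class yields a property of density. Two facts connect the two sides. If a homomorphism
  \<open>f\<close> from \<open>M\<close> to \<open>P\<close> vanishes on a dense submodule, it factors through a torsion module, and so its
  values lie in \<open>\<sigma> P\<close> (\<open>sigma_dense_hom\<close>). Conversely, the kernel of a surjection onto a torsion module
  is dense (\<open>sigma_dense_kernel_surj\<close>). For a prehereditary \<open>\<sigma>\<close> the image may be any submodule of
  a torsion module, so surjectivity can be dropped (\<open>sigma_dense_kernel\<close>).

  Claim (1) applies the first fact to the projection of \<open>M\<close> to \<open>M/N\<close>. Claims (2) to (5) apply
  \<open>sigma_dense_kernel\<close> to the map \<open>r \<mapsto> r x + N\<close> from \<open>R\<close> to \<open>M/N\<close>, to the diagonal map from \<open>M\<close> to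
  \<open>M/N \<times> M/K\<close>, and to the restriction to \<open>N\<close> of the projection of \<open>M\<close> to \<open>M/K\<close>. The product
  \<open>M/N \<times> M/K\<close> is torsion because it is the sum of the images of its two factors; it is isomorphic to
  an object since an infinite universe is in bijection with its square.

  For claim (6) it is enough that the radical hull exhausts \<open>M/K\<close>, that is, that \<open>M/K\<close> has no nonzero
  quotient \<open>Q\<close> with \<open>\<sigma> Q = 0\<close>. The map from \<open>M\<close> to such a \<open>Q\<close> kills \<open>K\<close>. As \<open>K\<close> is dense in \<open>N\<close>, it
  sends \<open>N\<close> into \<open>\<sigma> Q = 0\<close>; as \<open>N\<close> is dense in \<open>M\<close>, it sends \<open>M\<close> into \<open>\<sigma> Q = 0\<close>. Being surjective,
  it leaves \<open>Q = 0\<close>.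
\<close>

section \<open>Submodules, images and products\<close>

lemma left_module_submodule:
  assumes M: "left_module R M" and N: "submodule N R M"
  shows "left_module R (M\<lparr>carrier := N\<rparr>)"
proof -
  interpret left_module R M by fact
  interpret N: abelian_subgroup N M by (rule submodule_abelian[OF N])
  have "abelian_group (M\<lparr>carrier := N\<rparr>)"
  proof (rule abelian_groupI)
    fix x assume "x \<in> carrier (M\<lparr>carrier := N\<rparr>)"
    then show "\<exists>y\<in>carrier (M\<lparr>carrier := N\<rparr>). y \<oplus>\<^bsub>M\<lparr>carrier := N\<rparr>\<^esub> x = \<zero>\<^bsub>M\<lparr>carrier := N\<rparr>\<^esub>"
      by (intro bexI[of _ "\<ominus>\<^bsub>M\<^esub> x"]) (auto intro: M.l_neg)
  qed (auto simp: M.a_ac)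
  then show ?thesis
    by (intro left_module.intro left_module_axioms.intro R.ring_axioms)
      (auto simp: smult_l_distr smult_r_distr smult_assoc1 submodule.smult_closed[OF N])
qed

lemma lmod_hom_restrict:
  "\<lbrakk>f \<in> lmod_hom R M P; N \<subseteq> carrier M\<rbrakk> \<Longrightarrow> f \<in> lmod_hom R (M\<lparr>carrier := N\<rparr>) P"
  by (auto simp: lmod_hom_def Pi_iff subset_iff)

lemma image_submodule:
  assumes M: "left_module R M" and P: "left_module R P" and f: "f \<in> lmod_hom R M P"
  shows "submodule (f ` carrier M) R P"
proof -
  interpret M: left_module R M by fact
  interpret P: left_module R P by fact
  show ?thesis
  proof (rule P.submoduleI)
    show "f ` carrier M \<subseteq> carrier P" using lmod_homD(1)[OF f] by blast
    show "\<zero>\<^bsub>P\<^esub> \<in> f ` carrier M"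
      using lmod_hom_zero[OF M P f] M.M.zero_closed by (metis image_eqI)
    show "x \<oplus>\<^bsub>P\<^esub> y \<in> f ` carrier M" if "x \<in> f ` carrier M" "y \<in> f ` carrier M" for x y
      using that by (auto simp: lmod_homD(2)[OF f, symmetric])
    show "\<ominus>\<^bsub>P\<^esub> x \<in> f ` carrier M" if "x \<in> f ` carrier M" for x
      using that by (auto simp: lmod_hom_neg[OF M P f, symmetric])
    show "r \<odot>\<^bsub>P\<^esub> x \<in> f ` carrier M" if "r \<in> carrier R" "x \<in> f ` carrier M" for r x
      using that by (auto simp: lmod_homD(3)[OF f, symmetric])
  qed
qed

lemma smult_right_hom:
  assumes "left_module R M" "x \<in> carrier M"
  shows "(\<lambda>r. r \<odot>\<^bsub>M\<^esub> x) \<in> lmod_hom R (regular_module R) M"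
proof -
  interpret left_module R M by fact
  show ?thesis
    using assms(2) by (auto simp: lmod_hom_def regular_module_def smult_l_distr smult_assoc1)
qed

definition prod_module ::
    "('r, 'a, 'f) module_scheme \<Rightarrow> ('r, 'b, 'g) module_scheme \<Rightarrow> ('r, 'a \<times> 'b) module"
  where "prod_module A B = \<lparr>carrier = carrier A \<times> carrier B,
    monoid.mult = undefined, monoid.one = undefined, ring.zero = (\<zero>\<^bsub>A\<^esub>, \<zero>\<^bsub>B\<^esub>),
    ring.add = (\<lambda>x y. (fst x \<oplus>\<^bsub>A\<^esub> fst y, snd x \<oplus>\<^bsub>B\<^esub> snd y)),
    smult = (\<lambda>r x. (r \<odot>\<^bsub>A\<^esub> fst x, r \<odot>\<^bsub>B\<^esub> snd x))\<rparr>"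

lemma prod_module_simps [simp]:
  "carrier (prod_module A B) = carrier A \<times> carrier B"
  "\<zero>\<^bsub>prod_module A B\<^esub> = (\<zero>\<^bsub>A\<^esub>, \<zero>\<^bsub>B\<^esub>)"
  "x \<oplus>\<^bsub>prod_module A B\<^esub> y = (fst x \<oplus>\<^bsub>A\<^esub> fst y, snd x \<oplus>\<^bsub>B\<^esub> snd y)"
  "r \<odot>\<^bsub>prod_module A B\<^esub> x = (r \<odot>\<^bsub>A\<^esub> fst x, r \<odot>\<^bsub>B\<^esub> snd x)"
  by (simp_all add: prod_module_def)

lemma prod_left_module:
  assumes A: "left_module R A" and B: "left_module R B"
  shows "left_module R (prod_module A B)"
proof -
  interpret A: left_module R A by fact
  interpret B: left_module R B by fact
  have "abelian_group (prod_module A B)"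
  proof (rule abelian_groupI)
    fix x assume "x \<in> carrier (prod_module A B)"
    then show "\<exists>y\<in>carrier (prod_module A B). y \<oplus>\<^bsub>prod_module A B\<^esub> x = \<zero>\<^bsub>prod_module A B\<^esub>"
      by (intro bexI[of _ "(\<ominus>\<^bsub>A\<^esub> fst x, \<ominus>\<^bsub>B\<^esub> snd x)"]) (auto simp: A.M.l_neg B.M.l_neg)
  qed (auto simp: A.M.a_ac B.M.a_ac)
  then show ?thesis
    by (intro left_module.intro left_module_axioms.intro A.R.ring_axioms)
      (auto simp: A.smult_l_distr A.smult_r_distr A.smult_assoc1
        B.smult_l_distr B.smult_r_distr B.smult_assoc1)
qed

lemma prod_has_copy:
  fixes A B :: "('r, 'u) module"
  assumes inf: "infinite (UNIV :: 'u set)" and A: "left_module R A" and B: "left_module R B"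
  obtains Q :: "('r, 'u) module" and e
  where "left_module R Q" "e \<in> lmod_iso R (prod_module A B) Q"
proof -
  obtain e :: "'u \<times> 'u \<Rightarrow> 'u" where "bij_betw e (UNIV \<times> UNIV) UNIV"
    using card_of_Times_same_infinite[OF inf] unfolding card_of_ordIso[symmetric] by blast
  then have "inj_on e (carrier (prod_module A B))"
    using bij_betw_imp_inj_on inj_on_subset by (metis UNIV_Times_UNIV subset_UNIV)
  then show ?thesis by (rule has_copy_inj[OF prod_left_module[OF A B]]) (rule that)
qed


section \<open>Dense submodules and torsion quotients\<close>

text \<open>The homomorphism \<open>f\<close> factors through \<open>M/N\<close>, all of which lies in the preradical.\<close>

lemma sigma_dense_hom:
  fixes \<sigma> :: "('r, 'u) module \<Rightarrow> 'u set" and P' :: "('r, 'u) module"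
    and M :: "('r, 'm) module" and P :: "('r, 'p) module"
  assumes \<sigma>: "preradical R \<sigma>" and M: "left_module R M" and P: "left_module R P"
    and P': "left_module R P'" "g \<in> lmod_iso R P P'"
    and d: "sigma_dense R \<sigma> N M" and f: "f \<in> lmod_hom R M P"
    and z: "\<And>x. x \<in> N \<Longrightarrow> f x = \<zero>\<^bsub>P\<^esub>" and x: "x \<in> carrier M"
  shows "f x \<in> pr_at R \<sigma> P"
proof -
  interpret M: left_module R M by fact
  interpret P: left_module R P by fact
  have N: "submodule N R M" and t: "pr_at R \<sigma> (quot_module M N) = carrier (quot_module M N)"
    using d unfolding sigma_dense_def by auto
  have ker: "f x = f y" if "x \<in> carrier M" "y \<in> carrier M" "N +>\<^bsub>M\<^esub> x = N +>\<^bsub>M\<^esub> y" for x y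
  proof -
    have "f (x \<oplus>\<^bsub>M\<^esub> \<ominus>\<^bsub>M\<^esub> y) = \<zero>\<^bsub>P\<^esub>"
      using that quot_proj_eq[OF M N] z by blast
    then have "f x \<oplus>\<^bsub>P\<^esub> \<ominus>\<^bsub>P\<^esub> f y = \<zero>\<^bsub>P\<^esub>"
      using that by (simp add: lmod_homD[OF f] lmod_hom_neg[OF M P f])
    then show ?thesis
      using that lmod_homD(1)[OF f] P.M.minus_equality[of "f x" "\<ominus>\<^bsub>P\<^esub> f y"] P.M.minus_minus by simp
  qed
  obtain h where h: "h \<in> lmod_hom R (quot_module M N) P"
      "\<And>x. x \<in> carrier M \<Longrightarrow> h (N +>\<^bsub>M\<^esub> x) = f x"
    by (rule lmod_hom_factor[OF M quot_proj_hom[OF M N] quot_proj_surj[OF M N] f])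
      (rule ker, assumption+, rule that)
  have "N +>\<^bsub>M\<^esub> x \<in> pr_at R \<sigma> (quot_module M N)"
    unfolding t using lmod_homD(1)[OF quot_proj_hom[OF M N] x] by simp
  then show ?thesis
    using pr_at_hom[OF \<sigma> quot_left_module[OF M N] h(1) P'] h(2)[OF x] by metis
qed

text \<open>
  By the first isomorphism theorem \<open>P\<close> is an object isomorphic to the quotient by the kernel. The
  domain \<open>M\<close> may live on any type, which is what makes this usable for the regular module.
\<close>

lemma sigma_dense_kernel_surj:
  fixes \<sigma> :: "('r, 'u) module \<Rightarrow> 'u set" and P :: "('r, 'u) module" and M :: "('r, 'm) module"
  assumes \<sigma>: "preradical R \<sigma>" and M: "left_module R M" and P: "P \<in> torsion_class R \<sigma>"
    and f: "f \<in> lmod_hom R M P" "f ` carrier M = carrier P"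
  shows "sigma_dense R \<sigma> {x \<in> carrier M. f x = \<zero>\<^bsub>P\<^esub>} M"
proof -
  let ?K = "{x \<in> carrier M. f x = \<zero>\<^bsub>P\<^esub>}"
  let ?Q = "quot_module M ?K"
  have lP: "left_module R P" and t: "\<sigma> P = carrier P"
    using P unfolding torsion_class_def by auto
  interpret M: left_module R M by fact
  interpret P: left_module R P by fact
  have K: "submodule ?K R M" by (rule kernel_submodule[OF M lP f(1)])
  have eq: "?K +>\<^bsub>M\<^esub> x = ?K +>\<^bsub>M\<^esub> y \<longleftrightarrow> f x = f y" if "x \<in> carrier M" "y \<in> carrier M" for x y
  proof -
    have "?K +>\<^bsub>M\<^esub> x = ?K +>\<^bsub>M\<^esub> y \<longleftrightarrow> f x \<oplus>\<^bsub>P\<^esub> \<ominus>\<^bsub>P\<^esub> f y = \<zero>\<^bsub>P\<^esub>"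
      using that quot_proj_eq[OF M K]
      by (simp add: lmod_homD[OF f(1)] lmod_hom_neg[OF M lP f(1)])
    also have "\<dots> \<longleftrightarrow> f x = f y"
      using that lmod_homD(1)[OF f(1)] P.M.minus_equality[of "f x" "\<ominus>\<^bsub>P\<^esub> f y"]
        P.M.minus_minus P.M.r_neg by auto
    finally show ?thesis .
  qed
  obtain h where h: "h \<in> lmod_hom R ?Q P" "\<And>x. x \<in> carrier M \<Longrightarrow> h (?K +>\<^bsub>M\<^esub> x) = f x"
    by (rule lmod_hom_factor[OF M quot_proj_hom[OF M K] quot_proj_surj[OF M K] f(1)])
      (simp only: eq, rule that)
  have rep: "\<exists>x\<in>carrier M. q = ?K +>\<^bsub>M\<^esub> x" if "q \<in> carrier ?Q" for q
    using that unfolding quot_proj_surj[OF M K, symmetric] by blast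
  have "inj_on h (carrier ?Q)"
  proof (rule inj_onI)
    fix p q assume *: "p \<in> carrier ?Q" "q \<in> carrier ?Q" "h p = h q"
    obtain x y where xy: "x \<in> carrier M" "p = ?K +>\<^bsub>M\<^esub> x" "y \<in> carrier M" "q = ?K +>\<^bsub>M\<^esub> y"
      using rep[OF *(1)] rep[OF *(2)] by blast
    have "f x = f y" using *(3) unfolding xy(2,4) h(2)[OF xy(1)] h(2)[OF xy(3)] .
    then show "p = q" unfolding xy(2,4) eq[OF xy(1,3)] .
  qed
  moreover have "h ` carrier ?Q = carrier P"
    unfolding quot_proj_surj[OF M K, symmetric] image_image f(2)[symmetric]
    by (rule image_cong[OF refl h(2)])
  ultimately have "h \<in> lmod_iso R ?Q P"
    using h(1) by (simp add: lmod_iso_def bij_betw_def)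
  then have "pr_at R \<sigma> ?Q = {q \<in> carrier ?Q. h q \<in> carrier P}"
    using pr_at_iso[OF \<sigma> quot_left_module[OF M K] lP] t by simp
  then show ?thesis
    using K lmod_homD(1)[OF h(1)] unfolding sigma_dense_def by blast
qed

text \<open>
  The quotient of an object has sets as elements. Replacing it by an isomorphic object gives a
  module on which \<open>\<sigma>\<close> itself, and closure properties of its torsion class, can be used.
\<close>

lemma sigma_dense_obtain_torsion:
  fixes \<sigma> :: "('r, 'u) module \<Rightarrow> 'u set" and M :: "('r, 'u) module"
  assumes \<sigma>: "preradical R \<sigma>" and M: "left_module R M" and d: "sigma_dense R \<sigma> N M"
  obtains P :: "('r, 'u) module" and f
  where "P \<in> torsion_class R \<sigma>" "f \<in> lmod_hom R M P"
    "\<And>x. x \<in> carrier M \<Longrightarrow> f x = \<zero>\<^bsub>P\<^esub> \<longleftrightarrow> x \<in> N"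
proof -
  have N: "submodule N R M" and t: "pr_at R \<sigma> (quot_module M N) = carrier (quot_module M N)"
    using d unfolding sigma_dense_def by auto
  let ?Q = "quot_module M N"
  note Q = quot_left_module[OF M N]
  obtain P :: "('r, 'u) module" and e where e: "left_module R P" "e \<in> lmod_iso R ?Q P"
    by (rule quot_has_copy[OF M N]) (rule that)
  let ?f = "e \<circ> (\<lambda>x. N +>\<^bsub>M\<^esub> x)"
  have "carrier P \<subseteq> \<sigma> P"
    using t unfolding pr_at_iso[OF \<sigma> Q e] lmod_isoD(3)[OF e(2), symmetric] by blast
  moreover have "\<sigma> P \<subseteq> carrier P"
    using left_module.submodule_subset[OF e(1) preradicalD(1)[OF \<sigma> e(1)]] .
  ultimately have "P \<in> torsion_class R \<sigma>" using e(1) unfolding torsion_class_def by blast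
  moreover have "?f \<in> lmod_hom R M P"
    by (rule lmod_hom_comp[OF quot_proj_hom[OF M N] lmod_isoD(1)[OF e(2)]])
  moreover have "?f x = \<zero>\<^bsub>P\<^esub> \<longleftrightarrow> x \<in> N" if x: "x \<in> carrier M" for x
  proof -
    interpret Q: left_module R ?Q by (rule Q)
    have "?f x = \<zero>\<^bsub>P\<^esub> \<longleftrightarrow> e (N +>\<^bsub>M\<^esub> x) = e \<zero>\<^bsub>?Q\<^esub>"
      using lmod_hom_zero[OF Q e(1) lmod_isoD(1)[OF e(2)]] by simp
    also have "\<dots> \<longleftrightarrow> N +>\<^bsub>M\<^esub> x = \<zero>\<^bsub>?Q\<^esub>"
      using inj_on_eq_iff[OF lmod_isoD(2)[OF e(2)]] Q.M.zero_closed
        lmod_homD(1)[OF quot_proj_hom[OF M N] x] by simp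
    also have "\<dots> \<longleftrightarrow> x \<in> N" by (rule quot_proj_eq_zero[OF M N x])
    finally show ?thesis .
  qed
  ultimately show ?thesis by (rule that)
qed

lemma sigma_dense_superset:
  fixes \<sigma> :: "('r, 'u) module \<Rightarrow> 'u set" and M :: "('r, 'u) module"
  assumes \<sigma>: "preradical R \<sigma>" and M: "left_module R M" and N: "submodule N R M"
    and d: "sigma_dense R \<sigma> K M" and sub: "K \<subseteq> N"
  shows "sigma_dense R \<sigma> N M"
proof -
  interpret M: left_module R M by fact
  let ?Q = "quot_module M N"
  have K: "submodule K R M" using d unfolding sigma_dense_def by blast
  obtain P :: "('r, 'u) module" and e where e: "left_module R P" "e \<in> lmod_iso R ?Q P"
    by (rule quot_has_copy[OF M N]) (rule that)
  have "N +>\<^bsub>M\<^esub> x \<in> pr_at R \<sigma> ?Q" if "x \<in> carrier M" for x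
    by (rule sigma_dense_hom[OF \<sigma> M quot_left_module[OF M N] e d quot_proj_hom[OF M N] _ that])
      (use quot_proj_eq_zero[OF M N] sub M.submodule_subset[OF K] in blast)
  then have "carrier ?Q \<subseteq> pr_at R \<sigma> ?Q"
    unfolding quot_proj_surj[OF M N, symmetric] by blast
  moreover have "pr_at R \<sigma> ?Q \<subseteq> carrier ?Q" by (auto simp: pr_at_def)
  ultimately show ?thesis using N unfolding sigma_dense_def by blast
qed

text \<open>The product is the sum of the images of its factors, and these images lie in the preradical.\<close>

lemma prod_torsion:
  fixes \<sigma> :: "('r, 'u) module \<Rightarrow> 'u set" and A B Q :: "('r, 'u) module"
  assumes \<sigma>: "preradical R \<sigma>" and A: "A \<in> torsion_class R \<sigma>" and B: "B \<in> torsion_class R \<sigma>"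
    and Q: "left_module R Q" and e: "e \<in> lmod_iso R (prod_module A B) Q"
  shows "Q \<in> torsion_class R \<sigma>"
proof -
  have lA: "left_module R A" and lB: "left_module R B"
    and tA: "\<sigma> A = carrier A" and tB: "\<sigma> B = carrier B"
    using A B unfolding torsion_class_def by auto
  interpret A: left_module R A by fact
  interpret B: left_module R B by fact
  interpret Q: left_module R Q by fact
  have S: "submodule (\<sigma> Q) R Q" by (rule preradicalD(1)[OF \<sigma> Q])
  interpret S: abelian_subgroup "\<sigma> Q" Q by (rule Q.submodule_abelian[OF S])
  have eh: "e \<in> lmod_hom R (prod_module A B) Q" by (rule lmod_isoD(1)[OF e])
  have i: "(\<lambda>a. (a, \<zero>\<^bsub>B\<^esub>)) \<in> lmod_hom R A (prod_module A B)"
    and j: "(\<lambda>b. (\<zero>\<^bsub>A\<^esub>, b)) \<in> lmod_hom R B (prod_module A B)"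
    by (auto simp: lmod_hom_def)
  have "e (a, b) \<in> \<sigma> Q" if ab: "a \<in> carrier A" "b \<in> carrier B" for a b
  proof -
    have "e (a, \<zero>\<^bsub>B\<^esub>) \<in> \<sigma> Q" "e (\<zero>\<^bsub>A\<^esub>, b) \<in> \<sigma> Q"
      using preradicalD(2)[OF \<sigma> lA Q lmod_hom_comp[OF i eh], of a]
        preradicalD(2)[OF \<sigma> lB Q lmod_hom_comp[OF j eh], of b] ab tA tB by auto
    then have "e (a, \<zero>\<^bsub>B\<^esub>) \<oplus>\<^bsub>Q\<^esub> e (\<zero>\<^bsub>A\<^esub>, b) \<in> \<sigma> Q" by (rule S.a_closed)
    moreover have "e (a, b) = e (a, \<zero>\<^bsub>B\<^esub>) \<oplus>\<^bsub>Q\<^esub> e (\<zero>\<^bsub>A\<^esub>, b)"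
      using lmod_homD(2)[OF eh, of "(a, \<zero>\<^bsub>B\<^esub>)" "(\<zero>\<^bsub>A\<^esub>, b)"] ab by simp
    ultimately show ?thesis by simp
  qed
  then have "carrier Q \<subseteq> \<sigma> Q" unfolding lmod_isoD(3)[OF e, symmetric] by auto
  then show ?thesis using Q Q.submodule_subset[OF S] unfolding torsion_class_def by blast
qed


section \<open>Prehereditary preradicals\<close>

text \<open>The image of \<open>f\<close> is a submodule of a torsion module, hence torsion.\<close>

lemma sigma_dense_kernel:
  fixes \<sigma> :: "('r, 'u) module \<Rightarrow> 'u set" and P :: "('r, 'u) module" and M :: "('r, 'm) module"
  assumes \<sigma>: "preradical R \<sigma>" and her: "prehereditary R \<sigma>"
    and M: "left_module R M" and P: "P \<in> torsion_class R \<sigma>" and f: "f \<in> lmod_hom R M P"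
  shows "sigma_dense R \<sigma> {x \<in> carrier M. f x = \<zero>\<^bsub>P\<^esub>} M"
proof -
  let ?I = "P\<lparr>carrier := f ` carrier M\<rparr>"
  have "left_module R P" using P unfolding torsion_class_def by blast
  then have I: "?I \<in> torsion_class R \<sigma>"
    using her P image_submodule[OF M _ f] unfolding prehereditary_def by blast
  have f': "f \<in> lmod_hom R M ?I" using f by (auto simp: lmod_hom_def)
  show ?thesis using sigma_dense_kernel_surj[OF \<sigma> M I f'] by simp
qed

lemma sigma_dense_residual:
  fixes \<sigma> :: "('r, 'u) module \<Rightarrow> 'u set" and M :: "('r, 'u) module"
  assumes \<sigma>: "preradical R \<sigma>" and her: "prehereditary R \<sigma>" and M: "left_module R M"
    and d: "sigma_dense R \<sigma> N M" and x: "x \<in> carrier M"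
  shows "sigma_dense R \<sigma> (residual R M N x) (regular_module R)"
proof -
  interpret M: left_module R M by fact
  obtain P :: "('r, 'u) module" and f where P: "P \<in> torsion_class R \<sigma>" "f \<in> lmod_hom R M P"
      "\<And>x. x \<in> carrier M \<Longrightarrow> f x = \<zero>\<^bsub>P\<^esub> \<longleftrightarrow> x \<in> N"
    by (rule sigma_dense_obtain_torsion[OF \<sigma> M d]) (rule that)
  have "residual R M N x = {r \<in> carrier (regular_module R). (f \<circ> (\<lambda>r. r \<odot>\<^bsub>M\<^esub> x)) r = \<zero>\<^bsub>P\<^esub>}"
    using x P(3) by (auto simp: residual_def regular_module_def)
  then show ?thesis
    using sigma_dense_kernel[OF \<sigma> her regular_left_module[OF M.R.ring_axioms] P(1)
        lmod_hom_comp[OF smult_right_hom[OF M x] P(2)]] by simp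
qed

lemma sigma_dense_Int:
  fixes \<sigma> :: "('r, 'u) module \<Rightarrow> 'u set" and M :: "('r, 'u) module"
  assumes inf: "infinite (UNIV :: 'u set)" and \<sigma>: "preradical R \<sigma>" and her: "prehereditary R \<sigma>"
    and M: "left_module R M" and N: "sigma_dense R \<sigma> N M" and K: "sigma_dense R \<sigma> K M"
  shows "sigma_dense R \<sigma> (N \<inter> K) M"
proof -
  interpret M: left_module R M by fact
  have sub: "N \<subseteq> carrier M" using N M.submodule_subset unfolding sigma_dense_def by blast
  obtain A :: "('r, 'u) module" and f where A: "A \<in> torsion_class R \<sigma>" "f \<in> lmod_hom R M A"
      "\<And>x. x \<in> carrier M \<Longrightarrow> f x = \<zero>\<^bsub>A\<^esub> \<longleftrightarrow> x \<in> N"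
    by (rule sigma_dense_obtain_torsion[OF \<sigma> M N]) (rule that)
  obtain B :: "('r, 'u) module" and g where B: "B \<in> torsion_class R \<sigma>" "g \<in> lmod_hom R M B"
      "\<And>x. x \<in> carrier M \<Longrightarrow> g x = \<zero>\<^bsub>B\<^esub> \<longleftrightarrow> x \<in> K"
    by (rule sigma_dense_obtain_torsion[OF \<sigma> M K]) (rule that)
  have lA: "left_module R A" and lB: "left_module R B"
    using A(1) B(1) unfolding torsion_class_def by auto
  note AB = prod_left_module[OF lA lB]
  interpret AB: left_module R "prod_module A B" by (rule AB)
  obtain Q :: "('r, 'u) module" and e where
    Q: "left_module R Q" and e: "e \<in> lmod_iso R (prod_module A B) Q"
    by (rule prod_has_copy[OF inf lA lB]) (rule that)
  have h: "(\<lambda>x. (f x, g x)) \<in> lmod_hom R M (prod_module A B)"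
    using A(2) B(2) by (auto simp: lmod_hom_def)
  have "(e \<circ> (\<lambda>x. (f x, g x))) x = \<zero>\<^bsub>Q\<^esub> \<longleftrightarrow> x \<in> N \<inter> K" if x: "x \<in> carrier M" for x
  proof -
    have "(e \<circ> (\<lambda>x. (f x, g x))) x = \<zero>\<^bsub>Q\<^esub> \<longleftrightarrow> e (f x, g x) = e \<zero>\<^bsub>prod_module A B\<^esub>"
      using lmod_hom_zero[OF AB Q lmod_isoD(1)[OF e]] by simp
    also have "\<dots> \<longleftrightarrow> (f x, g x) = \<zero>\<^bsub>prod_module A B\<^esub>"
      by (rule inj_on_eq_iff[OF lmod_isoD(2)[OF e] lmod_homD(1)[OF h x] AB.M.zero_closed])
    also have "\<dots> \<longleftrightarrow> x \<in> N \<inter> K" using A(3) B(3) x by simp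
    finally show ?thesis .
  qed
  then have "{x \<in> carrier M. (e \<circ> (\<lambda>x. (f x, g x))) x = \<zero>\<^bsub>Q\<^esub>} = N \<inter> K"
    using sub by blast
  then show ?thesis
    using sigma_dense_kernel[OF \<sigma> her M prod_torsion[OF \<sigma> A(1) B(1) Q e]
        lmod_hom_comp[OF h lmod_isoD(1)[OF e]]] by simp
qed

lemma sigma_dense_restrict:
  fixes \<sigma> :: "('r, 'u) module \<Rightarrow> 'u set" and M :: "('r, 'u) module"
  assumes \<sigma>: "preradical R \<sigma>" and her: "prehereditary R \<sigma>" and M: "left_module R M"
    and N: "submodule N R M" and d: "sigma_dense R \<sigma> K M"
  shows "sigma_dense R \<sigma> (K \<inter> N) (M\<lparr>carrier := N\<rparr>)"
proof -
  have sub: "N \<subseteq> carrier M" by (rule left_module.submodule_subset[OF M N])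
  obtain P :: "('r, 'u) module" and f where P: "P \<in> torsion_class R \<sigma>" "f \<in> lmod_hom R M P"
      "\<And>x. x \<in> carrier M \<Longrightarrow> f x = \<zero>\<^bsub>P\<^esub> \<longleftrightarrow> x \<in> K"
    by (rule sigma_dense_obtain_torsion[OF \<sigma> M d]) (rule that)
  have "{x \<in> carrier (M\<lparr>carrier := N\<rparr>). f x = \<zero>\<^bsub>P\<^esub>} = K \<inter> N"
    using P(3) sub by auto
  then show ?thesis
    using sigma_dense_kernel[OF \<sigma> her left_module_submodule[OF M N] P(1)
        lmod_hom_restrict[OF P(2) sub]] by simp
qed


section \<open>Essentially coidempotent preradicals\<close>

text \<open>
  Essential coidempotence reduces the claim to the radical hull, whose torsion class is closed under
  extensions: a map out of \<open>M\<close> that kills \<open>K\<close> and has a target without torsion kills first \<open>N\<close>, then \<open>M\<close>.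
\<close>

lemma sigma_dense_trans:
  fixes \<sigma> :: "('r, 'u) module \<Rightarrow> 'u set" and M :: "('r, 'u) module"
  assumes \<sigma>: "preradical R \<sigma>" and co: "essentially_coidempotent R \<sigma>" and M: "left_module R M"
    and K: "submodule K R M" and N: "submodule N R M"
    and KN: "sigma_dense R \<sigma> K (M\<lparr>carrier := N\<rparr>)" and NM: "sigma_dense R \<sigma> N M"
  shows "sigma_dense R \<sigma> K M"
proof -
  interpret M: left_module R M by fact
  let ?Q = "quot_module M K"
  have sub: "N \<subseteq> carrier M" by (rule M.submodule_subset[OF N])
  have KM: "K \<subseteq> carrier M" by (rule M.submodule_subset[OF K])
  note Q = quot_left_module[OF M K]
  obtain P :: "('r, 'u) module" and e where P: "left_module R P" and e: "e \<in> lmod_iso R ?Q P"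
    by (rule quot_has_copy[OF M K]) (rule that)
  interpret P: left_module R P by fact
  let ?p = "e \<circ> (\<lambda>x. K +>\<^bsub>M\<^esub> x)"
  have p: "?p \<in> lmod_hom R M P"
    by (rule lmod_hom_comp[OF quot_proj_hom[OF M K] lmod_isoD(1)[OF e]])
  have ps: "?p ` carrier M = carrier P"
    unfolding image_comp[symmetric] quot_proj_surj[OF M K] by (rule lmod_isoD(3)[OF e])
  have pK: "?p x = \<zero>\<^bsub>P\<^esub>" if x: "x \<in> K" for x
  proof -
    have "K +>\<^bsub>M\<^esub> x = \<zero>\<^bsub>?Q\<^esub>" using quot_proj_eq_zero[OF M K] x KM by blast
    then show ?thesis using lmod_hom_zero[OF Q P lmod_isoD(1)[OF e]] by simp
  qed
  have "carrier P \<subseteq> L" if L: "submodule L R P"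
    and z: "pr_at R \<sigma> (quot_module P L) = {\<zero>\<^bsub>quot_module P L\<^esub>}" for L
  proof -
    let ?T = "quot_module P L"
    let ?g = "(\<lambda>x. L +>\<^bsub>P\<^esub> x) \<circ> ?p"
    note T = quot_left_module[OF P L]
    obtain T' :: "('r, 'u) module" and t where t: "left_module R T'" "t \<in> lmod_iso R ?T T'"
      by (rule quot_has_copy[OF P L]) (rule that)
    have g: "?g \<in> lmod_hom R M ?T" by (rule lmod_hom_comp[OF p quot_proj_hom[OF P L]])
    have gK: "?g x = \<zero>\<^bsub>?T\<^esub>" if "x \<in> K" for x
      using pK[OF that] lmod_hom_zero[OF P T quot_proj_hom[OF P L]] by simp
    have gN: "?g x = \<zero>\<^bsub>?T\<^esub>" if "x \<in> N" for x
      using sigma_dense_hom[OF \<sigma> left_module_submodule[OF M N] T t KN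
          lmod_hom_restrict[OF g sub] gK, of x] that z by simp
    have gM: "?g x = \<zero>\<^bsub>?T\<^esub>" if "x \<in> carrier M" for x
      using sigma_dense_hom[OF \<sigma> M T t NM g gN that] z by simp
    have "?p x \<in> L" if "x \<in> carrier M" for x
      using gM[OF that] quot_proj_eq_zero[OF P L lmod_homD(1)[OF p that]] by simp
    then show ?thesis unfolding ps[symmetric] by blast
  qed
  then have "carrier P \<subseteq> radical_hull R \<sigma> P" unfolding radical_hull_def by blast
  moreover have "radical_hull R \<sigma> P \<subseteq> carrier P"
    by (rule P.submodule_subset[OF preradicalD(1)[OF radical_hull_preradical[OF \<sigma>] P]])
  ultimately have "\<sigma> P = carrier P"
    using co P unfolding essentially_coidempotent_def by blast
  then have "pr_at R \<sigma> ?Q = carrier ?Q"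
    using pr_at_iso[OF \<sigma> Q P e] lmod_homD(1)[OF lmod_isoD(1)[OF e]] by auto
  then show ?thesis using K unfolding sigma_dense_def by blast
qed


section \<open>The calculus of dense submodules\<close>

theorem proposition24:
  fixes R :: "'r ring" and M :: "('r, 'u) module" and N K :: "'u set"
    and \<sigma> :: "('r, 'u) module \<Rightarrow> 'u set"
  assumes "infinite (UNIV :: 'u set)"
    and "ring R" and "left_module R M" and "submodule N R M" and "submodule K R M"
    and "preradical R \<sigma>"
  shows
    "(sigma_dense R \<sigma> K M \<and> K \<subseteq> N \<longrightarrow> sigma_dense R \<sigma> N M) \<and>
     (prehereditary R \<sigma> \<longrightarrow>
        (\<forall>x\<in>carrier M. sigma_dense R \<sigma> N M \<longrightarrow>
           sigma_dense R \<sigma> (residual R M N x) (regular_module R)) \<and>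
        (sigma_dense R \<sigma> K M \<and> sigma_dense R \<sigma> N M \<longrightarrow> sigma_dense R \<sigma> (N \<inter> K) M) \<and>
        (sigma_dense R \<sigma> K M \<and> K \<subseteq> N \<longrightarrow> sigma_dense R \<sigma> K (M\<lparr>carrier := N\<rparr>)) \<and>
        (sigma_dense R \<sigma> K M \<longrightarrow> sigma_dense R \<sigma> (K \<inter> N) (M\<lparr>carrier := N\<rparr>))) \<and>
     (essentially_coidempotent R \<sigma> \<longrightarrow>
        (sigma_dense R \<sigma> K (M\<lparr>carrier := N\<rparr>) \<and> sigma_dense R \<sigma> N M \<longrightarrow> sigma_dense R \<sigma> K M))"
proof (intro conjI impI ballI; (elim conjE)?)
  note M = \<open>left_module R M\<close> and N = \<open>submodule N R M\<close> and K = \<open>submodule K R M\<close>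
    and \<sigma> = \<open>preradical R \<sigma>\<close>
  show "sigma_dense R \<sigma> N M" if "sigma_dense R \<sigma> K M" "K \<subseteq> N"
    by (rule sigma_dense_superset[OF \<sigma> M N that])
  show "sigma_dense R \<sigma> (residual R M N x) (regular_module R)"
    if "prehereditary R \<sigma>" "x \<in> carrier M" "sigma_dense R \<sigma> N M" for x
    by (rule sigma_dense_residual[OF \<sigma> that(1) M that(3,2)])
  show "sigma_dense R \<sigma> (N \<inter> K) M"
    if "prehereditary R \<sigma>" "sigma_dense R \<sigma> K M" "sigma_dense R \<sigma> N M"
    by (rule sigma_dense_Int[OF \<open>infinite UNIV\<close> \<sigma> that(1) M that(3,2)])
  show restrict: "sigma_dense R \<sigma> (K \<inter> N) (M\<lparr>carrier := N\<rparr>)"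
    if "prehereditary R \<sigma>" "sigma_dense R \<sigma> K M"
    by (rule sigma_dense_restrict[OF \<sigma> that(1) M N that(2)])
  show "sigma_dense R \<sigma> K (M\<lparr>carrier := N\<rparr>)"
    if "prehereditary R \<sigma>" "sigma_dense R \<sigma> K M" "K \<subseteq> N"
    using restrict[OF that(1,2)] that(3) by (simp add: Int_absorb2)
  show "sigma_dense R \<sigma> K M" if "essentially_coidempotent R \<sigma>"
    "sigma_dense R \<sigma> K (M\<lparr>carrier := N\<rparr>)" "sigma_dense R \<sigma> N M"
    by (rule sigma_dense_trans[OF \<sigma> that(1) M K N that(2,3)])
qed

end
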